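(* Every real Banach space that is lush is a local-GL-space.
   Context: All spaces are over the real field. $B_E$, $S_E$, $E^*$ denote the closed unit ball, the unit sphere and the dual of $E$. For $x^*\in S_{E^*}$ and $\varepsilon>0$, $S(x^*,\varepsilon)=\{z\in B_E: x^*(z)>1-\varepsilon\}$. A Banach space $E$ is lush if for every $x,y\in S_E$ and every $\varepsilon>0$ there is $x^*\in S_{E^*}$ such that, with $S=S(x^*,\varepsilon)$, $x\in S$ and $\mathrm{dist}(y,\mathrm{aco}(S))<\varepsilon$, where $\mathrm{aco}$ denotes the absolutely convex hull. A Banach space $E$ is a GL-space (generalized-lush space) if for every $x\in S_E$ and every $\varepsilon>0$ there is $x^*\in S_{E^*}$ such that, with $S=S(x^*,\varepsilon)$, one has $x\in S$ and $\mathrm{dist}(y,S)+\mathrm{dist}(y,-S)<2+\varepsilon$ for all $y\in S_E$. A Banach space $E$ is a local-GL-space if for every separable subspace $X\subset E$ there is a (closed) subspace $Y$ of $E$ which is a GL-space (with the inherited norm) and satisfies $X\subset Y\subset E$. *)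

theory Defs
  imports "HOL-Analysis.Analysis"
begin

(* A real Banach space E is represented by its carrier, a closed linear subspace of an ambient
   Banach type 'a; the ambient space itself is UNIV.  Lushness and generalized lushness are thus
   intrinsic: the functionals are the elements of the dual of E, not of the dual of 'a. *)

(* Membership in S_{E^*}.  The values of f outside E are irrelevant.  Boundedness must be required
   explicitly, since the real supremum of an unbounded set is unspecified. *)
definition dual_sphere :: "'a::real_normed_vector set \<Rightarrow> ('a \<Rightarrow> real) set" where
  "dual_sphere E = {f.
     (\<forall>x\<in>E. \<forall>y\<in>E. f (x + y) = f x + f y) \<and>
     (\<forall>c. \<forall>x\<in>E. f (c *\<^sub>R x) = c * f x) \<and>
     bdd_above ((\<lambda>z. \<bar>f z\<bar>) ` (E \<inter> cball 0 1)) \<and>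
     (SUP z\<in>E \<inter> cball 0 1. \<bar>f z\<bar>) = 1}"

definition slice :: "'a::real_normed_vector set \<Rightarrow> ('a \<Rightarrow> real) \<Rightarrow> real \<Rightarrow> 'a set" where
  "slice E f \<epsilon> = {z \<in> E \<inter> cball 0 1. f z > 1 - \<epsilon>}"

definition absolutely_convex :: "'a::real_vector set \<Rightarrow> bool" where
  "absolutely_convex C \<longleftrightarrow> convex C \<and> (\<forall>c. \<forall>x\<in>C. \<bar>c\<bar> \<le> 1 \<longrightarrow> c *\<^sub>R x \<in> C)"

definition aco :: "'a::real_vector set \<Rightarrow> 'a set" where
  "aco S = absolutely_convex hull S"

(* In the two definitions below the slice contains x, so no distance is taken to the empty set
   (where infdist would be 0). *)
definition lush :: "'a::real_normed_vector set \<Rightarrow> bool" where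
  "lush E \<longleftrightarrow>
     (\<forall>x \<in> E \<inter> sphere 0 1. \<forall>y \<in> E \<inter> sphere 0 1. \<forall>\<epsilon>>0. \<exists>f \<in> dual_sphere E.
        x \<in> slice E f \<epsilon> \<and> infdist y (aco (slice E f \<epsilon>)) < \<epsilon>)"

definition GL_space :: "'a::real_normed_vector set \<Rightarrow> bool" where
  "GL_space E \<longleftrightarrow>
     (\<forall>x \<in> E \<inter> sphere 0 1. \<forall>\<epsilon>>0. \<exists>f \<in> dual_sphere E.
        x \<in> slice E f \<epsilon> \<and>
        (\<forall>y \<in> E \<inter> sphere 0 1.
           infdist y (slice E f \<epsilon>) + infdist y (uminus ` slice E f \<epsilon>) < 2 + \<epsilon>))"

definition local_GL_space :: "'a::real_normed_vector set \<Rightarrow> bool" where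
  "local_GL_space E \<longleftrightarrow>
     (\<forall>X. subspace X \<and> X \<subseteq> E \<and> separable_space (top_of_set X) \<longrightarrow>
        (\<exists>Y. subspace Y \<and> closed Y \<and> X \<subseteq> Y \<and> Y \<subseteq> E \<and> GL_space Y))"

(* For the whole space the relative dual sphere is the unit sphere of the library's dual space. *)
lemma dual_sphere_UNIV:
  "dual_sphere (UNIV :: 'a::real_normed_vector set) = blinfun_apply ` sphere 0 1"
proof -
  have norm_eq: "(SUP z\<in>cball 0 1. \<bar>blinfun_apply F z\<bar>) = norm F"
    and bdd: "bdd_above ((\<lambda>z. \<bar>blinfun_apply F z\<bar>) ` cball 0 1)" for F :: "'a \<Rightarrow>\<^sub>L real"
  proof -
    have le: "\<bar>blinfun_apply F z\<bar> \<le> norm F" if "z \<in> cball 0 1" for z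
      using norm_blinfun[of F z] that mult_left_mono[of "norm z" 1 "norm F"] by simp
    show bdd: "bdd_above ((\<lambda>z. \<bar>blinfun_apply F z\<bar>) ` cball 0 1)"
      using le by (rule bdd_aboveI2)
    let ?s = "SUP z\<in>cball 0 1. \<bar>blinfun_apply F z\<bar>"
    have s: "\<bar>blinfun_apply F z\<bar> \<le> ?s" if "norm z \<le> 1" for z
      using that bdd by (intro cSUP_upper) auto
    have "norm F \<le> ?s"
    proof (rule norm_blinfun_bound)
      show "0 \<le> ?s" using s[of 0] by simp
      fix x
      show "norm (blinfun_apply F x) \<le> ?s * norm x"
      proof (cases "x = 0")
        case False
        then have "\<bar>blinfun_apply F (x /\<^sub>R norm x)\<bar> \<le> ?s" by (intro s) simp
        with False show ?thesis by (simp add: blinfun.scaleR_right abs_mult field_simps)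
      qed (simp add: blinfun.zero_right)
    qed
    moreover have "?s \<le> norm F" using le by (intro cSUP_least) auto
    ultimately show "?s = norm F" by simp
  qed
  show ?thesis
  proof (intro equalityI subsetI)
    fix f :: "'a \<Rightarrow> real" assume f: "f \<in> dual_sphere UNIV"
    have s: "\<bar>f z\<bar> \<le> 1" if "norm z \<le> 1" for z
      using f that cSUP_upper[of z "cball 0 1" "\<lambda>z. \<bar>f z\<bar>"] by (auto simp: dual_sphere_def)
    have scale: "f (c *\<^sub>R x) = c * f x" for c x using f by (auto simp: dual_sphere_def)
    have "\<bar>f x\<bar> \<le> norm x * 1" for x
    proof (cases "x = 0")
      case True
      then show ?thesis using scale[of 0 0] by simp
    next
      case False
      then have "\<bar>f (x /\<^sub>R norm x)\<bar> \<le> 1" by (intro s) simp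
      with False show ?thesis by (simp add: scale abs_mult field_simps)
    qed
    then have "bounded_linear f"
      using f by (intro bounded_linear_intro[where K = 1]) (auto simp: dual_sphere_def)
    then have F: "blinfun_apply (Blinfun f) = f" by (rule bounded_linear_Blinfun_apply)
    moreover have "norm (Blinfun f) = 1"
      using f norm_eq[of "Blinfun f"] unfolding F by (simp add: dual_sphere_def)
    ultimately show "f \<in> blinfun_apply ` sphere 0 1"
      by (metis image_eqI mem_sphere_0)
  next
    fix f :: "'a \<Rightarrow> real" assume "f \<in> blinfun_apply ` sphere 0 1"
    then show "f \<in> dual_sphere UNIV"
      using norm_eq bdd by (auto simp: dual_sphere_def blinfun.add_right blinfun.scaleR_right)
  qed
qed

end

(* Closing a countable dense subset of X under rational combinations and under the points that
   witness lushness gives a separable closed subspace Y containing X whose witnessing points lie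
   in Y.  Fix x in S_Y and a dense sequence (y_k) in S_Y.  Put X_0 = x; given X_k, lushness yields
   s_k, t_k in a slice through X_k such that y_k is close to u s_k - (1 - u) t_k, and X_{k+1} is
   the normalization of X_k + s_k + t_k.  A functional that almost norms X_{k+1} almost norms each
   of X_k, s_k and t_k, so with rapidly decreasing tolerances the n-th functional is almost 1 at x
   and at all s_k, t_k with k < n.  A weak-star cluster point is then almost 1 at x and at all s_k
   and t_k, and the decomposition y = u s - (1 - u) t gives
   |y - s| + |y + t| <= 2 (1 - u) + 2 u = 2 for s, t in its slice. *)

theory Submission
  imports Defs
begin

section \<open>Absolutely convex hulls of convex sets\<close>

lemma convex_pos_combination:
  assumes "convex S" "p \<in> S" "q \<in> S" "0 \<le> a" "0 \<le> b"
  obtains r where "r \<in> S" "a *\<^sub>R p + b *\<^sub>R q = (a + b) *\<^sub>R r"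
proof (cases "a + b = 0")
  case True
  with assms have "a = 0" "b = 0" by auto
  with assms that[of p] show ?thesis by simp
next
  case False
  have "(a / (a + b)) *\<^sub>R p + (b / (a + b)) *\<^sub>R q \<in> S"
    using assms False by (intro convexD) (auto simp: add_divide_distrib[symmetric])
  moreover have "a *\<^sub>R p + b *\<^sub>R q = (a + b) *\<^sub>R ((a / (a + b)) *\<^sub>R p + (b / (a + b)) *\<^sub>R q)"
    using False by (simp add: scaleR_add_right)
  ultimately show ?thesis using that by blast
qed

text \<open>Combinations of this form already make up an absolutely convex set containing
  \<open>S\<close>: convexity of \<open>S\<close> merges the positive parts of a mixture into one
  point, and likewise the negative parts, while swapping \<open>s\<close> and \<open>t\<close> gives
  symmetry.\<close>

lemma aco_convexE:
  assumes S: "convex S" and z: "z \<in> aco S"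
  obtains u s t where "0 \<le> u" "u \<le> 1" "s \<in> S" "t \<in> S" "z = u *\<^sub>R s - (1 - u) *\<^sub>R t"
proof -
  let ?A = "{a *\<^sub>R s - b *\<^sub>R t | a b s t. 0 \<le> a \<and> 0 \<le> b \<and> a + b = 1 \<and> s \<in> S \<and> t \<in> S}"
  have conv: "convex ?A"
  proof (rule convexI)
    fix x y and c d :: real
    assume "x \<in> ?A" "y \<in> ?A" and cd: "0 \<le> c" "0 \<le> d" "c + d = 1"
    then obtain a b s t a' b' s' t' where
      x: "x = a *\<^sub>R s - b *\<^sub>R t" "0 \<le> a" "0 \<le> b" "a + b = 1" "s \<in> S" "t \<in> S" and
      y: "y = a' *\<^sub>R s' - b' *\<^sub>R t'" "0 \<le> a'" "0 \<le> b'" "a' + b' = 1" "s' \<in> S" "t' \<in> S"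
      by auto
    obtain p where p: "p \<in> S" "(c * a) *\<^sub>R s + (d * a') *\<^sub>R s' = (c * a + d * a') *\<^sub>R p"
      using convex_pos_combination[OF S x(5) y(5), of "c * a" "d * a'"] cd x y by auto
    obtain q where q: "q \<in> S" "(c * b) *\<^sub>R t + (d * b') *\<^sub>R t' = (c * b + d * b') *\<^sub>R q"
      using convex_pos_combination[OF S x(6) y(6), of "c * b" "d * b'"] cd x y by auto
    have "c *\<^sub>R x + d *\<^sub>R y
        = ((c * a) *\<^sub>R s + (d * a') *\<^sub>R s') - ((c * b) *\<^sub>R t + (d * b') *\<^sub>R t')"
      by (simp add: x y algebra_simps)
    also have "\<dots> = (c * a + d * a') *\<^sub>R p - (c * b + d * b') *\<^sub>R q"
      by (simp only: p q)
    finally have eq: "c *\<^sub>R x + d *\<^sub>R y = (c * a + d * a') *\<^sub>R p - (c * b + d * b') *\<^sub>R q" .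
    have "(c * a + d * a') + (c * b + d * b') = c * (a + b) + d * (a' + b')"
      by (simp add: algebra_simps)
    then have "(c * a + d * a') + (c * b + d * b') = 1" using x y cd by simp
    moreover have "0 \<le> c * a + d * a'" "0 \<le> c * b + d * b'" using x y cd by auto
    ultimately show "c *\<^sub>R x + d *\<^sub>R y \<in> ?A" using eq p(1) q(1) by blast
  qed
  have neg: "- x \<in> ?A" if xA: "x \<in> ?A" for x
  proof -
    from xA obtain a b s t where
      x: "x = a *\<^sub>R s - b *\<^sub>R t" "0 \<le> a" "0 \<le> b" "a + b = 1" "s \<in> S" "t \<in> S" by auto
    then have "- x = b *\<^sub>R t - a *\<^sub>R s" "b + a = 1" by auto
    with x show ?thesis by blast
  qed
  have "c *\<^sub>R x \<in> ?A" if "x \<in> ?A" "\<bar>c\<bar> \<le> 1" for c x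
  proof -
    \<comment> \<open>A multiple of \<open>x\<close> by \<open>c\<close> in [-1, 1] lies on the
      segment from \<open>- x\<close> to \<open>x\<close>.\<close>
    have "((1 + c) / 2) *\<^sub>R x + ((1 - c) / 2) *\<^sub>R (- x) \<in> ?A"
      using that neg by (intro convexD[OF conv]) (auto simp: field_simps abs_le_iff)
    moreover have "((1 + c) / 2) *\<^sub>R x + ((1 - c) / 2) *\<^sub>R (- x) = ((1 + c) / 2 - (1 - c) / 2) *\<^sub>R x"
      by (simp only: scaleR_diff_left scaleR_minus_right) simp
    moreover have "(1 + c) / 2 - (1 - c) / 2 = c" by (simp add: field_simps)
    ultimately show ?thesis by simp
  qed
  with conv have "absolutely_convex ?A" by (simp add: absolutely_convex_def)
  moreover have "S \<subseteq> ?A"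
  proof
    fix s assume "s \<in> S"
    then have "s = 1 *\<^sub>R s - 0 *\<^sub>R s \<and> (0::real) \<le> 1 \<and> (0::real) \<le> 0 \<and> (1::real) + 0 = 1 \<and> s \<in> S \<and> s \<in> S"
      by simp
    then show "s \<in> ?A" by blast
  qed
  ultimately have "aco S \<subseteq> ?A" unfolding aco_def by (intro hull_minimal)
  with z obtain a b s t where
    "z = a *\<^sub>R s - b *\<^sub>R t" "0 \<le> a" "0 \<le> b" "a + b = 1" "s \<in> S" "t \<in> S" by auto
  moreover from this have "b = 1 - a" "a \<le> 1" by auto
  ultimately show ?thesis using that by blast
qed

section \<open>Lushness through explicit witnesses\<close>

text \<open>The closed dual unit ball of the whole space. Unlike the unit sphere it is stable under
  weak-star cluster points; norm one is restored at the end by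
  \<open>dual_sphere_normalize\<close>.\<close>

definition contractive_functional :: "('a::real_normed_vector \<Rightarrow> real) \<Rightarrow> bool" where
  "contractive_functional f \<longleftrightarrow> linear f \<and> (\<forall>x. \<bar>f x\<bar> \<le> norm x)"

lemma contractive_functional_simps:
  assumes "contractive_functional f"
  shows "f (x + y) = f x + f y" "f (x - y) = f x - f y" "f (c *\<^sub>R x) = c * f x"
  using assms by (auto simp: contractive_functional_def linear_add linear_diff linear_scale)

lemma contractive_functional_le:
  "contractive_functional f \<Longrightarrow> f x \<le> norm x" "contractive_functional f \<Longrightarrow> \<bar>f x\<bar> \<le> norm x"
  unfolding contractive_functional_def by (auto intro: order_trans[OF abs_ge_self])

text \<open>Slice and hull are replaced by a few points and inequalities, which survive small
  changes of \<open>x\<close> and \<open>y\<close>. The last clause uses the form of hull elements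
  from \<open>aco_convexE\<close>.\<close>

definition lush_witness :: "'a::real_normed_vector \<Rightarrow> 'a \<Rightarrow> real \<Rightarrow> 'a \<Rightarrow> 'a \<Rightarrow> bool" where
  "lush_witness x y \<delta> s t \<longleftrightarrow>
     norm s \<le> 1 \<and> norm t \<le> 1 \<and>
     (\<exists>f. contractive_functional f \<and> f x > 1 - \<delta> \<and> f s > 1 - \<delta> \<and> f t > 1 - \<delta>) \<and>
     (\<exists>u. 0 \<le> u \<and> u \<le> 1 \<and> norm (y - (u *\<^sub>R s - (1 - u) *\<^sub>R t)) < \<delta>)"

text \<open>The witnessing points are taken in \<open>Y\<close> but the functional on the whole ambient space, so
  that no extension or restriction of functionals is needed when passing to subspaces.\<close>
definition has_lush_witnesses :: "'a::real_normed_vector set \<Rightarrow> bool" where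
  "has_lush_witnesses Y \<longleftrightarrow>
     (\<forall>x\<in>Y. \<forall>y\<in>Y. \<forall>\<delta>>0. norm x = 1 \<longrightarrow> norm y = 1 \<longrightarrow> (\<exists>s\<in>Y. \<exists>t\<in>Y. lush_witness x y \<delta> s t))"

lemma lush_imp_has_lush_witnesses:
  assumes "lush (UNIV :: 'a::real_normed_vector set)"
  shows "has_lush_witnesses (UNIV :: 'a set)"
  unfolding has_lush_witnesses_def
proof (intro ballI allI impI)
  fix x y :: 'a and \<delta> :: real assume *: "\<delta> > 0" "norm x = 1" "norm y = 1"
  obtain f :: "'a \<Rightarrow> real" where f: "f \<in> dual_sphere UNIV" "x \<in> slice UNIV f \<delta>"
    "infdist y (aco (slice UNIV f \<delta>)) < \<delta>"
    using assms * unfolding lush_def by fastforce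
  obtain F where F: "f = blinfun_apply F" "norm F = 1"
    using f(1) by (auto simp: dual_sphere_UNIV)
  have cf: "contractive_functional f"
    unfolding contractive_functional_def F(1)
    using norm_blinfun[of F] F(2) by (auto intro: bounded_linear.linear blinfun.bounded_linear_right)
  have "convex {z. f z > 1 - \<delta>}"
  proof -
    have "{z. f z > 1 - \<delta>} = f -` {1 - \<delta> <..}" by auto
    also have "convex \<dots>"
      using cf by (intro convex_linear_vimage) (auto simp: contractive_functional_def)
    finally show ?thesis .
  qed
  then have "convex (cball 0 1 \<inter> {z. f z > 1 - \<delta>})" by (intro convex_Int) auto
  also have "cball 0 1 \<inter> {z. f z > 1 - \<delta>} = slice UNIV f \<delta>" by (auto simp: slice_def)
  finally have conv: "convex (slice UNIV f \<delta>)" .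
  \<comment> \<open>The hull is nonempty, so \<open>infdist\<close> is a true infimum and not the
    default 0.\<close>
  have "x \<in> aco (slice UNIV f \<delta>)" using f(2) unfolding aco_def by (rule hull_inc)
  then have "aco (slice UNIV f \<delta>) \<noteq> {}" by blast
  with f(3) have "(INF z\<in>aco (slice UNIV f \<delta>). dist y z) < \<delta>" by (simp add: infdist_notempty)
  then obtain z where z: "z \<in> aco (slice UNIV f \<delta>)" "dist y z < \<delta>"
    using \<open>aco (slice UNIV f \<delta>) \<noteq> {}\<close> by (subst (asm) cINF_less_iff) auto
  from aco_convexE[OF conv z(1)] obtain u s t where u: "0 \<le> u" "u \<le> 1"
    "s \<in> slice UNIV f \<delta>" "t \<in> slice UNIV f \<delta>" "z = u *\<^sub>R s - (1 - u) *\<^sub>R t" by metis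
  have "lush_witness x y \<delta> s t"
    unfolding lush_witness_def using u z f(2) cf by (auto simp: slice_def dist_norm)
  then show "\<exists>s\<in>UNIV. \<exists>t\<in>UNIV. lush_witness x y \<delta> s t" by blast
qed

text \<open>The same \<open>f\<close> and \<open>u\<close> serve, since \<open>f\<close> and the
  distance to a point are 1-Lipschitz. Witnesses for dense points thereby serve the whole
  closure.\<close>

lemma lush_witness_perturb:
  assumes w: "lush_witness x y \<delta> s t" and "norm (x' - x) < \<eta>" "norm (y' - y) < \<eta>"
  shows "lush_witness x' y' (\<delta> + \<eta>) s t"
proof -
  obtain f u where f: "contractive_functional f" "f x > 1 - \<delta>" "f s > 1 - \<delta>" "f t > 1 - \<delta>"
    and u: "0 \<le> u" "u \<le> 1" "norm (y - (u *\<^sub>R s - (1 - u) *\<^sub>R t)) < \<delta>"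
    using w unfolding lush_witness_def by blast
  have \<eta>: "\<eta> > 0" using assms(2) norm_ge_zero order_le_less_trans by blast
  have "f x - f x' \<le> norm (x - x')"
    using contractive_functional_le(1)[OF f(1), of "x - x'"] f(1)
    by (simp add: contractive_functional_simps)
  then have "f x' > 1 - (\<delta> + \<eta>)" using f(2) assms(2) by (simp add: norm_minus_commute)
  moreover have "norm (y' - (u *\<^sub>R s - (1 - u) *\<^sub>R t)) < \<delta> + \<eta>"
    using norm_triangle_lt[of "y' - y" "y - (u *\<^sub>R s - (1 - u) *\<^sub>R t)"] u assms(3)
    by (simp add: algebra_simps)
  moreover have "f s > 1 - (\<delta> + \<eta>)" "f t > 1 - (\<delta> + \<eta>)" using f \<eta> by auto
  ultimately show ?thesis
    using w f(1) u(1,2) unfolding lush_witness_def by blast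
qed

section \<open>A separable subspace containing its own witnesses\<close>

text \<open>Rational coefficients allow \<open>D\<close> to be countable; real scalars come from
  limits of rational ones.\<close>

lemma closure_rational_subspace:
  assumes D: "0 \<in> D" "\<And>x y q. x \<in> D \<Longrightarrow> y \<in> D \<Longrightarrow> x + of_rat q *\<^sub>R y \<in> D"
  shows "subspace (closure (D :: 'a::real_normed_vector set))"
proof (rule subspaceI)
  show "0 \<in> closure D" using D(1) closure_subset by blast
next
  fix x y assume "x \<in> closure D" "y \<in> closure D"
  then obtain X Y where "\<And>n. X n \<in> D" "X \<longlonglongrightarrow> x" "\<And>n. Y n \<in> D" "Y \<longlonglongrightarrow> y"
    unfolding closure_sequential by metis
  then have "\<forall>n. X n + Y n \<in> D" "(\<lambda>n. X n + Y n) \<longlonglongrightarrow> x + y"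
    using D(2)[of "X _" "Y _" 1] by (auto intro: tendsto_add)
  then show "x + y \<in> closure D"
    unfolding closure_sequential by (intro exI[of _ "\<lambda>n. X n + Y n"] conjI)
next
  fix c :: real and x assume "x \<in> closure D"
  then obtain X where X: "\<And>n. X n \<in> D" "X \<longlonglongrightarrow> x"
    unfolding closure_sequential by metis
  have "c \<in> closure \<rat>" by (simp add: Rats_closure_real)
  then obtain R where R: "\<And>n. R n \<in> \<rat>" "R \<longlonglongrightarrow> c"
    unfolding closure_sequential by metis
  have "\<forall>n. R n *\<^sub>R X n \<in> D"
  proof
    fix n
    obtain q where "R n = of_rat q" using R(1)[of n] by (auto elim: Rats_cases)
    then show "R n *\<^sub>R X n \<in> D" using D(2)[OF D(1) X(1), of q] by simp
  qed
  moreover have "(\<lambda>n. R n *\<^sub>R X n) \<longlonglongrightarrow> c *\<^sub>R x" using R X by (intro tendsto_scaleR)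
  ultimately show "c *\<^sub>R x \<in> closure D"
    unfolding closure_sequential by (intro exI[of _ "\<lambda>n. R n *\<^sub>R X n"] conjI)
qed

text \<open>A countable index type packs countably many binary operations into one \<open>F\<close>.
  The stages of the iteration increase, so two arguments from different stages meet in the later
  one.\<close>

lemma countable_closing_off:
  fixes F :: "'i::countable \<Rightarrow> 'a \<Rightarrow> 'a \<Rightarrow> 'a"
  assumes C: "countable C"
  shows "\<exists>D. countable D \<and> C \<subseteq> D \<and> (\<forall>i. \<forall>x\<in>D. \<forall>y\<in>D. F i x y \<in> D)"
proof -
  define E where
    "E = rec_nat C (\<lambda>_ A. A \<union> (\<lambda>(i, x, y). F i x y) ` (UNIV \<times> A \<times> A))"
  have E0: "E 0 = C" and ES: "E (Suc n) = E n \<union> (\<lambda>(i, x, y). F i x y) ` (UNIV \<times> E n \<times> E n)" for n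
    by (simp_all add: E_def)
  have "countable (E n)" for n
    by (induction n) (simp_all add: E0 ES C)
  then have "countable (\<Union>n. E n)" by auto
  moreover have "C \<subseteq> (\<Union>n. E n)" using E0 by blast
  moreover have "F i x y \<in> (\<Union>n. E n)" if "x \<in> (\<Union>n. E n)" "y \<in> (\<Union>n. E n)" for i x y
  proof -
    from that obtain m n where mn: "x \<in> E m" "y \<in> E n" by blast
    have "E k \<subseteq> E l" if "k \<le> l" for k l
      by (rule lift_Suc_mono_le[of E, OF _ that]) (simp add: ES)
    from this[of m "max m n"] this[of n "max m n"] mn
    have "(i, x, y) \<in> UNIV \<times> E (max m n) \<times> E (max m n)" by auto
    from imageI[OF this, of "\<lambda>(i, x, y). F i x y"]
    have "F i x y \<in> E (Suc (max m n))" by (simp add: ES)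
    then show ?thesis by blast
  qed
  ultimately show ?thesis by (intro exI[of _ "\<Union>n. E n"]) blast
qed

text \<open>Normalizing \<open>d\<close> moves it by \<open>\<bar>norm d - 1\<bar>\<close>, at most
  its distance to the unit vector \<open>x\<close>, so the error at most doubles. A distance below 1
  excludes \<open>d = 0\<close>.\<close>

lemma sgn_approx_in_dense:
  fixes x :: "'a::real_normed_vector"
  assumes "x \<in> closure D" "norm x = 1" "e > 0"
  obtains d where "d \<in> D" "d \<noteq> 0" "norm (x - sgn d) < e"
proof -
  obtain d where d: "d \<in> D" "norm (d - x) < min 1 (e / 2)"
    using assms unfolding closure_approachable dist_norm by (metis half_gt_zero min_less_iff_conj zero_less_one)
  then have "d \<noteq> 0" using assms(2) by auto
  have "norm (d - sgn d) = \<bar>norm d - 1\<bar>"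
  proof -
    have "d - sgn d = (norm d - 1) *\<^sub>R sgn d"
      using \<open>d \<noteq> 0\<close> by (simp add: sgn_div_norm algebra_simps)
    then show ?thesis using \<open>d \<noteq> 0\<close> by (simp add: norm_sgn)
  qed
  also have "\<dots> \<le> norm (d - x)" using norm_triangle_ineq3[of d x] assms(2) by simp
  finally have "norm (x - sgn d) \<le> 2 * norm (d - x)"
    using norm_triangle_ineq[of "x - d" "d - sgn d"] by (simp add: norm_minus_commute)
  then show ?thesis using that d \<open>d \<noteq> 0\<close> by auto
qed

lemma separable_lush_subspace:
  fixes C :: "'a::real_normed_vector set"
  assumes C: "countable C"
    and wit: "has_lush_witnesses (UNIV :: 'a set)"
  obtains D where "countable D" "C \<subseteq> D" "subspace (closure D)" "has_lush_witnesses (closure D)"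
proof -
  \<comment> \<open>\<open>t\<close> is chosen after \<open>s\<close>, so that the two are witnesses
    jointly.\<close>
  define s t where "s = (\<lambda>x y n. SOME s. \<exists>t. lush_witness (x :: 'a) y (1 / real (Suc n)) s t)"
    and "t = (\<lambda>x y n. SOME t. lush_witness x y (1 / real (Suc n)) (s x y n) t)"
  have st: "lush_witness x y (1 / real (Suc n)) (s x y n) (t x y n)"
    if "norm x = 1" "norm y = 1" for x y n
  proof -
    have "\<exists>s t. lush_witness x y (1 / real (Suc n)) s t" 
      using wit that unfolding has_lush_witnesses_def by simp
    then have "\<exists>t. lush_witness x y (1 / real (Suc n)) (s x y n) t" unfolding s_def by (rule someI_ex)
    then show ?thesis unfolding t_def by (rule someI_ex)
  qed
  \<comment> \<open>Rational combinations, and both witnesses for every tolerance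
    \<open>1 / Suc n\<close>. Since \<open>D\<close> need not contain unit vectors, witnesses are
    taken at normalized arguments.\<close>
  define F :: "rat + nat + nat \<Rightarrow> 'a \<Rightarrow> 'a \<Rightarrow> 'a" where
    "F i x y = (case i of Inl q \<Rightarrow> x + of_rat q *\<^sub>R y | Inr (Inl n) \<Rightarrow> s (sgn x) (sgn y) n
                 | Inr (Inr n) \<Rightarrow> t (sgn x) (sgn y) n)" for i x y
  obtain D where D: "countable D" "insert 0 C \<subseteq> D"
    and cl: "\<forall>i. \<forall>x\<in>D. \<forall>y\<in>D. F i x y \<in> D"
    using countable_closing_off[OF countable_insert[OF C], of 0 F] by auto
  have lin: "x + of_rat q *\<^sub>R y \<in> D" and s: "s (sgn x) (sgn y) n \<in> D" and t: "t (sgn x) (sgn y) n \<in> D"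
    if "x \<in> D" "y \<in> D" for x y q n
    using cl[rule_format, OF that, of "Inl q"] cl[rule_format, OF that, of "Inr (Inl n)"]
      cl[rule_format, OF that, of "Inr (Inr n)"] by (simp_all add: F_def)
  have "\<exists>s\<in>closure D. \<exists>t\<in>closure D. lush_witness x y \<delta> s t"
    if x: "x \<in> closure D" "norm x = 1" and y: "y \<in> closure D" "norm y = 1" and "\<delta> > 0" for x y \<delta>
  proof -
    obtain n where n: "1 / real (Suc n) < \<delta>"
      using \<open>\<delta> > 0\<close> nat_approx_posE by blast
    \<comment> \<open>The slack left by \<open>1 / Suc n\<close> is the allowed perturbation, so the
      tolerances add up to \<open>\<delta>\<close>.\<close>
    obtain a where a: "a \<in> D" "a \<noteq> 0" "norm (x - sgn a) < \<delta> - 1 / real (Suc n)"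
      using sgn_approx_in_dense[OF x, of "\<delta> - 1 / real (Suc n)"] n by auto
    obtain b where b: "b \<in> D" "b \<noteq> 0" "norm (y - sgn b) < \<delta> - 1 / real (Suc n)"
      using sgn_approx_in_dense[OF y, of "\<delta> - 1 / real (Suc n)"] n by auto
    have "lush_witness (sgn a) (sgn b) (1 / Suc n) (s (sgn a) (sgn b) n) (t (sgn a) (sgn b) n)"
      using a b by (intro st) (auto simp: norm_sgn)
    from lush_witness_perturb[OF this a(3) b(3)]
    have "lush_witness x y \<delta> (s (sgn a) (sgn b) n) (t (sgn a) (sgn b) n)" by simp
    then show ?thesis using s[OF a(1) b(1)] t[OF a(1) b(1)] closure_subset by blast
  qed
  then have "has_lush_witnesses (closure D)" by (simp add: has_lush_witnesses_def)
  moreover have "subspace (closure D)" using D lin by (intro closure_rational_subspace) auto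
  ultimately show ?thesis using D by (intro that) auto
qed

section \<open>Weak-star compactness\<close>

text \<open>Banach-Alaoglu: the functionals lie in a product of compact intervals, compact by
  Tychonoff. The ambient space may be nonseparable, where a convergent subsequence can fail to
  exist; hence a cluster point.\<close>

lemma contractive_functional_cluster_point:
  assumes f: "\<And>n. contractive_functional (f n :: 'a::real_normed_vector \<Rightarrow> real)"
  obtains g where "contractive_functional g"
    "\<And>z c. eventually (\<lambda>n. c \<le> f n z) sequentially \<Longrightarrow> c \<le> g z"
proof -
  define K :: "('a \<Rightarrow> real) set" where "K = (\<Pi>\<^sub>E z\<in>UNIV. {- norm z..norm z})"
  have "compactin (product_topology (\<lambda>_. euclidean) UNIV) K"
    unfolding K_def compactin_PiE by auto
  then have "compact K" by (simp add: euclidean_product_topology)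
  moreover have "f n \<in> K" for n
    using contractive_functional_le(2)[OF f] by (auto simp: K_def abs_le_iff minus_le_iff)
  ultimately obtain g where g: "g \<in> K" "inf (nhds g) (filtermap f sequentially) \<noteq> bot"
    unfolding compact_filter
    by (metis (mono_tags, lifting) always_eventually eventually_filtermap filtermap_bot_iff trivial_limit_sequentially)
  \<comment> \<open>Linearity and lower bounds define closed sets of functions, so each passes to
    \<open>g\<close> by this fact.\<close>
  have cluster: "g \<in> A" if "closed A" "eventually (\<lambda>n. f n \<in> A) sequentially" for A
  proof (rule ccontr)
    assume "g \<notin> A"
    then have "eventually (\<lambda>h. h \<in> - A) (nhds g)"
      using \<open>closed A\<close> by (intro eventually_nhds_in_open) auto
    moreover have "eventually (\<lambda>h. h \<in> A) (filtermap f sequentially)"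
      using that by (simp add: eventually_filtermap)
    ultimately have "eventually (\<lambda>h. False) (inf (nhds g) (filtermap f sequentially))"
      unfolding eventually_inf by (intro exI conjI) auto
    with g(2) show False by simp
  qed
  have cont: "continuous_on UNIV (\<lambda>h :: 'a \<Rightarrow> real. h z)" for z
    by (rule continuous_on_product_coordinates)
  have add: "g (x + y) = g x + g y" for x y
  proof -
    have "g \<in> {h. h (x + y) = h x + h y}"
      by (rule cluster) (auto intro!: closed_Collect_eq continuous_intros cont
          simp: contractive_functional_simps[OF f])
    then show ?thesis by simp
  qed
  have scale: "g (c *\<^sub>R x) = c * g x" for c x
  proof -
    have "g \<in> {h. h (c *\<^sub>R x) = c * h x}"
      by (rule cluster) (auto intro!: closed_Collect_eq continuous_intros cont
          simp: contractive_functional_simps[OF f])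
    then show ?thesis by simp
  qed
  have "contractive_functional g"
    using g(1) add scale by (auto simp: contractive_functional_def K_def PiE_iff abs_le_iff minus_le_iff intro!: linearI)
  moreover have "c \<le> g z" if "eventually (\<lambda>n. c \<le> f n z) sequentially" for z c
  proof -
    have "g \<in> {h. c \<le> h z}"
      by (rule cluster) (use that in \<open>auto intro!: closed_Collect_le continuous_intros cont\<close>)
    then show ?thesis by simp
  qed
  ultimately show ?thesis using that by blast
qed

section \<open>One functional for a whole sequence\<close>

text \<open>By \<open>f\<close>, the norm of \<open>x + s + t\<close> is at least
  \<open>3 - 3 * \<delta>\<close>, so \<open>g x + g s + g t\<close> is at least
  \<open>3 * g (sgn (x + s + t)) - 3 * \<delta>\<close>. None of the three values exceeds 1, so each
  deficit is bounded by the sum of all three, which is at most \<open>d\<close>.\<close>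

lemma functional_at_sgn_sum:
  assumes g: "contractive_functional g" and f: "contractive_functional f"
    and n: "norm x \<le> 1" "norm s \<le> 1" "norm t \<le> 1"
    and fx: "f x > 1 - \<delta>" "f s > 1 - \<delta>" "f t > 1 - \<delta>"
  defines "d \<equiv> 3 * (1 - g (sgn (x + s + t))) + 3 * \<delta>"
  shows "1 - g x \<le> d" "1 - g s \<le> d" "1 - g t \<le> d"
proof -
  let ?v = "x + s + t"
  let ?N = "norm ?v"
  have N: "?N \<le> 3" "?N \<ge> 3 - 3 * \<delta>"
  proof -
    show "?N \<le> 3" using norm_triangle_ineq[of "x + s" t] norm_triangle_ineq[of x s] n by linarith
    have "f x + f s + f t \<le> ?N"
      using contractive_functional_le(1)[OF f, of ?v] by (simp add: contractive_functional_simps[OF f])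
    then show "?N \<ge> 3 - 3 * \<delta>" using fx by linarith
  qed
  have "w = norm w *\<^sub>R sgn w" for w :: 'a by (cases "w = 0") (simp_all add: sgn_div_norm)
  then have "?v = ?N *\<^sub>R sgn ?v" .
  then have eq: "g x + g s + g t = ?N * g (sgn ?v)"
    by (metis contractive_functional_simps(1,3)[OF g])
  have "\<bar>g (sgn ?v)\<bar> \<le> 1"
    using contractive_functional_le(2)[OF g, of "sgn ?v"] by (simp add: norm_sgn split: if_splits)
  then have "(3 - ?N) * g (sgn ?v) \<le> (3 - ?N) * 1"
    using N by (intro mult_left_mono) auto
  then have sum: "g x + g s + g t \<ge> 3 * g (sgn ?v) - 3 * \<delta>" using N eq by (simp add: algebra_simps)
  have le1: "g x \<le> 1" "g s \<le> 1" "g t \<le> 1"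
    using n contractive_functional_le(1)[OF g] by (meson order_trans)+
  show "1 - g x \<le> d" unfolding d_def using sum le1 by (simp add: algebra_simps)
  show "1 - g s \<le> d" unfolding d_def using sum le1 by (simp add: algebra_simps)
  show "1 - g t \<le> d" unfolding d_def using sum le1 by (simp add: algebra_simps)
qed

text \<open>Lushness supplies a functional depending on the second point; here one \<open>g\<close>
  serves all \<open>y k\<close>, and only \<open>s\<close>, \<open>t\<close>, \<open>u\<close> vary
  with \<open>k\<close>.\<close>

lemma separable_lush_functional:
  fixes x :: "'a::real_normed_vector"
  assumes Y: "subspace Y" "x \<in> Y" "norm x = 1" "\<eta> > 0" "\<eta> \<le> 1"
    and yk: "\<And>k::nat. y k \<in> Y" "\<And>k. norm (y k) = 1"
    and wit: "has_lush_witnesses Y"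
  obtains g where "contractive_functional g" "g x \<ge> 1 - \<eta>"
    "\<forall>k. \<exists>s\<in>Y. \<exists>t\<in>Y. \<exists>u. norm s \<le> 1 \<and> norm t \<le> 1 \<and> g s \<ge> 1 - \<eta> \<and> g t \<ge> 1 - \<eta> \<and>
        0 \<le> u \<and> u \<le> 1 \<and> norm (y k - (u *\<^sub>R s - (1 - u) *\<^sub>R t)) < \<eta>"
proof -
  \<comment> \<open>chosen so that \<open>c k = \<eta> / 4 ^ k\<close> satisfies \<open>3 * c (Suc k) + 3 * \<delta> k = c k\<close>\<close>
  define \<delta> where "\<delta> k = \<eta> / 12 * (1 / 4) ^ k" for k :: nat
  have \<delta>: "0 < \<delta> k" "\<delta> k \<le> \<eta> / 12" for k
    using \<open>\<eta> > 0\<close> by (auto simp: \<delta>_def power_le_one mult_left_le)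
  have "\<exists>X. \<forall>k. (X k \<in> Y \<and> norm (X k) = 1 \<and> (k = 0 \<longrightarrow> X k = x)) \<and>
      (\<exists>s\<in>Y. \<exists>t\<in>Y. lush_witness (X k) (y k) (\<delta> k) s t \<and> X (Suc k) = sgn (X k + s + t))"
  proof (rule dependent_nat_choice, goal_cases)
    case 1
    then show ?case using Y by auto
  next
    case (2 z k)
    then obtain s t where st: "s \<in> Y" "t \<in> Y" "lush_witness z (y k) (\<delta> k) s t"
      using wit yk[of k] \<delta>(1)[of k] unfolding has_lush_witnesses_def by blast
    then obtain f where f: "contractive_functional f" "f z > 1 - \<delta> k" "f s > 1 - \<delta> k" "f t > 1 - \<delta> k"
      unfolding lush_witness_def by blast
    \<comment> \<open>The value exceeds \<open>3 - 3 * \<delta> k > 0\<close>, so the normalized sum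
      has norm 1.\<close>
    have "f (z + s + t) > 0"
      using f \<delta>(2)[of k] \<open>\<eta> \<le> 1\<close> by (simp add: contractive_functional_simps)
    then have "z + s + t \<noteq> 0" using contractive_functional_simps(3)[OF f(1), of 0 0] by auto
    moreover have "sgn (z + s + t) \<in> Y"
      using st 2 Y(1) by (auto simp: sgn_div_norm intro!: subspace_add subspace_scale)
    ultimately show ?case using st by (intro exI[of _ "sgn (z + s + t)"]) (auto simp: norm_sgn)
  qed
  then obtain X s t where X: "\<And>k. X k \<in> Y" "\<And>k. norm (X k) = 1" "X 0 = x"
    and st: "\<And>k. s k \<in> Y" "\<And>k. t k \<in> Y" "\<And>k. lush_witness (X k) (y k) (\<delta> k) (s k) (t k)"
    and XS: "\<And>k. X (Suc k) = sgn (X k + s k + t k)"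
    by metis
  obtain f u where f: "\<And>k. contractive_functional (f k)"
      "\<And>k. f k (X k) > 1 - \<delta> k" "\<And>k. f k (s k) > 1 - \<delta> k" "\<And>k. f k (t k) > 1 - \<delta> k"
    and u: "\<And>k. 0 \<le> u k" "\<And>k. u k \<le> 1"
      "\<And>k. norm (y k - (u k *\<^sub>R s k - (1 - u k) *\<^sub>R t k)) < \<delta> k"
    using st(3) unfolding lush_witness_def by metis
  have nst: "norm (s k) \<le> 1" "norm (t k) \<le> 1" for k
    using st(3) unfolding lush_witness_def by blast+
  \<comment> \<open>Two indices: \<open>f k\<close> bounds the norm of
    \<open>X k + s k + t k\<close>, while the values estimated are those of any
    \<open>f n\<close>.\<close>
  note prev = functional_at_sgn_sum[OF f(1) f(1) eq_refl[OF X(2)] nst f(2,3,4), folded XS]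
  define c where "c k = \<eta> * (1 / 4) ^ k" for k :: nat
  have c: "3 * c (Suc k) + 3 * \<delta> k = c k" "\<delta> k \<le> c k" "c k \<le> \<eta>" for k
    using \<open>\<eta> > 0\<close> by (auto simp: c_def \<delta>_def power_le_one mult_left_le)
  \<comment> \<open>Downward induction from \<open>n\<close>, where \<open>f n\<close> is good by
    its choice. Each step down triples the deficit and adds \<open>3 * \<delta> k\<close>, turning
    \<open>c (Suc k)\<close> into exactly \<open>c k\<close>.\<close>
  have est: "1 - f n (X k) \<le> c k" if "k \<le> n" for n k
    using that
  proof (induction k rule: inc_induct)
    case base
    then show ?case using f(2)[of n] c(2)[of n] by linarith
  next
    case (step k)
    then show ?case using prev(1)[of n k] c(1)[of k] by (simp add: algebra_simps)
  qed
  \<comment> \<open>\<open>s k\<close> and \<open>t k\<close> are controlled through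
    \<open>X (Suc k)\<close>, hence the strict \<open>k < n\<close>.\<close>
  have ev: "f n x \<ge> 1 - \<eta>" "f n (s k) \<ge> 1 - \<eta>" "f n (t k) \<ge> 1 - \<eta>" if "k < n" for n k
    using est[of 0 n] est[of "Suc k" n] prev(2,3)[of n k] c(1)[of k] c(3)[of k] c(3)[of 0] that X(3)
    by auto
  obtain g where g: "contractive_functional g"
    "\<And>z c. eventually (\<lambda>n. c \<le> f n z) sequentially \<Longrightarrow> c \<le> g z"
    using contractive_functional_cluster_point[of f] f(1) by blast
  have "g x \<ge> 1 - \<eta>"
    by (rule g(2), rule eventually_mono[OF eventually_gt_at_top[of 0]], erule ev)
  have "g (s k) \<ge> 1 - \<eta>" "g (t k) \<ge> 1 - \<eta>" for k
    by (rule g(2), rule eventually_mono[OF eventually_gt_at_top[of k]], erule ev)+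
  moreover have "norm (y k - (u k *\<^sub>R s k - (1 - u k) *\<^sub>R t k)) < \<eta>" for k
    using u(3)[of k] \<delta>(2)[of k] \<open>\<eta> > 0\<close> by linarith
  ultimately have "\<exists>s\<in>Y. \<exists>t\<in>Y. \<exists>u. norm s \<le> 1 \<and> norm t \<le> 1 \<and> g s \<ge> 1 - \<eta> \<and> g t \<ge> 1 - \<eta> \<and>
        0 \<le> u \<and> u \<le> 1 \<and> norm (y k - (u *\<^sub>R s - (1 - u) *\<^sub>R t)) < \<eta>" for k
    using st(1,2) nst u(1,2) by (intro bexI[of _ "s k"] bexI[of _ "t k"] exI[of _ "u k"]) auto
  then show ?thesis using that[OF g(1) \<open>g x \<ge> 1 - \<eta>\<close>] by blast
qed

section \<open>The GL property of the separable subspace\<close>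

text \<open>On \<open>Y\<close> the functional \<open>g\<close> has a norm \<open>M\<close> with
  \<open>0 < M \<le> 1\<close>. Dividing by \<open>M\<close> gives norm one and does not lower
  nonnegative values.\<close>

lemma dual_sphere_normalize:
  assumes Y: "subspace Y" "x \<in> Y" "norm x = 1" and g: "contractive_functional g" "g x > 0"
  obtains f where "f \<in> dual_sphere Y" "\<And>z. 0 \<le> g z \<Longrightarrow> g z \<le> f z"
proof -
  let ?B = "Y \<inter> cball 0 1"
  define M where "M = (SUP z\<in>?B. \<bar>g z\<bar>)"
  have bdd: "bdd_above ((\<lambda>z. \<bar>g z\<bar>) ` ?B)"
    using contractive_functional_le(2)[OF g(1)] by (intro bdd_aboveI2[of _ _ 1]) (auto intro: order_trans)
  have up: "\<bar>g z\<bar> \<le> M" if "z \<in> ?B" for z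
    unfolding M_def using that bdd by (intro cSUP_upper)
  have "M > 0" using up[of x] Y g(2) by auto
  have ne: "?B \<noteq> {}" using Y by auto
  have "M \<le> 1"
    unfolding M_def using contractive_functional_le(2)[OF g(1)] ne
    by (intro cSUP_least) (auto intro: order_trans)
  define f where "f z = g z / M" for z
  have up': "\<bar>f z\<bar> \<le> 1" if "z \<in> ?B" for z
    using up[OF that] \<open>M > 0\<close> by (simp add: f_def)
  have bdd': "bdd_above ((\<lambda>z. \<bar>f z\<bar>) ` ?B)" using up' by (intro bdd_aboveI2)
  let ?s = "SUP z\<in>?B. \<bar>f z\<bar>"
  have "\<bar>g z\<bar> \<le> ?s * M" if "z \<in> ?B" for z
    using cSUP_upper[OF that bdd'] \<open>M > 0\<close> by (simp add: f_def field_simps)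
  with ne have "(SUP z\<in>?B. \<bar>g z\<bar>) \<le> ?s * M" by (rule cSUP_least)
  then have "1 \<le> ?s" using \<open>M > 0\<close> unfolding M_def[symmetric] by simp
  moreover have "?s \<le> 1" using ne up' by (rule cSUP_least)
  ultimately have "f \<in> dual_sphere Y"
    unfolding dual_sphere_def
    using bdd' by (simp add: f_def contractive_functional_simps[OF g(1)] add_divide_distrib)
  moreover have "g z \<le> f z" if "0 \<le> g z" for z
    using that \<open>M > 0\<close> \<open>M \<le> 1\<close> by (simp add: f_def field_simps mult_left_le_one_le)
  ultimately show ?thesis using that by blast
qed

text \<open>The normalized nonzero points of \<open>D\<close> are dense in the unit sphere of
  \<open>Y\<close>, so a functional serving them serves every \<open>z\<close> up to a further error
  \<open>\<eta>\<close>.\<close>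

lemma separable_lush_imp_GL_space:
  fixes D :: "'a::real_normed_vector set"
  defines "Y \<equiv> closure D"
  assumes D: "countable D" and Y: "subspace Y"
    and wit: "has_lush_witnesses Y"
  shows "GL_space Y"
  unfolding GL_space_def
proof (intro ballI allI impI)
  fix x and \<epsilon> :: real assume "x \<in> Y \<inter> sphere 0 1" and "\<epsilon> > 0"
  then have x: "x \<in> Y" "norm x = 1" by auto
  \<comment> \<open>Each of the two distances picks up an error below \<open>2 * \<eta>\<close>,
    hence the factor 4; the minimum with 1 keeps \<open>g x\<close> positive.\<close>
  define \<eta> where "\<eta> = min 1 \<epsilon> / 4"
  have \<eta>: "\<eta> > 0" "\<eta> < 1" "4 * \<eta> \<le> \<epsilon>" using \<open>\<epsilon> > 0\<close> by (auto simp: \<eta>_def)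
  \<comment> \<open>The unit vector \<open>x\<close> makes \<open>D - {0}\<close> nonempty, so
    \<open>from_nat_into\<close> takes its values there.\<close>
  obtain d0 where "d0 \<in> D" "d0 \<noteq> 0" "norm (x - sgn d0) < 1"
    by (rule sgn_approx_in_dense[of x D 1]) (use x in \<open>auto simp: Y_def\<close>)
  then have ne: "D - {0} \<noteq> {}" by auto
  define y where "y k = sgn (from_nat_into (D - {0}) k)" for k
  have d: "from_nat_into (D - {0}) k \<in> D - {0}" for k using from_nat_into[OF ne] .
  have yk: "y k \<in> Y" "norm (y k) = 1" for k
  proof -
    have "from_nat_into (D - {0}) k \<in> Y" using d[of k] closure_subset unfolding Y_def by blast
    then show "y k \<in> Y" unfolding y_def sgn_div_norm by (intro subspace_scale Y)
    show "norm (y k) = 1" using d[of k] by (simp add: y_def norm_sgn)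
  qed
  obtain g where g: "contractive_functional g" "g x \<ge> 1 - \<eta>"
    and st: "\<forall>k. \<exists>s\<in>Y. \<exists>t\<in>Y. \<exists>u. norm s \<le> 1 \<and> norm t \<le> 1 \<and> g s \<ge> 1 - \<eta> \<and> g t \<ge> 1 - \<eta> \<and>
        0 \<le> u \<and> u \<le> 1 \<and> norm (y k - (u *\<^sub>R s - (1 - u) *\<^sub>R t)) < \<eta>"
    by (rule separable_lush_functional[OF Y x \<eta>(1) less_imp_le[OF \<eta>(2)] yk wit])
  have "g x > 0" using g \<eta> by linarith
  then obtain f where f: "f \<in> dual_sphere Y" "\<And>z. 0 \<le> g z \<Longrightarrow> g z \<le> f z"
    using dual_sphere_normalize[OF Y x g(1)] by metis
  \<comment> \<open>\<open>1 - \<eta>\<close> is positive, so the bound passes from \<open>g\<close>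
    to \<open>f\<close>, and \<open>\<eta> < \<epsilon>\<close> makes it strict.\<close>
  have slice: "z \<in> slice Y f \<epsilon>" if "z \<in> Y" "norm z \<le> 1" "g z \<ge> 1 - \<eta>" for z
    using that f(2)[of z] \<eta> by (auto simp: slice_def)
  have "infdist z (slice Y f \<epsilon>) + infdist z (uminus ` slice Y f \<epsilon>) < 2 + \<epsilon>"
    if z: "z \<in> Y \<inter> sphere 0 1" for z
  proof -
    obtain b where b: "b \<in> D" "b \<noteq> 0" "norm (z - sgn b) < \<eta>"
      by (rule sgn_approx_in_dense[of z D \<eta>]) (use z \<eta> in \<open>auto simp: Y_def\<close>)
    obtain k where k: "from_nat_into (D - {0}) k = b"
      using from_nat_into_surj[of "D - {0}" b] D b by auto
    obtain s t u where s: "s \<in> Y" "norm s \<le> 1" "g s \<ge> 1 - \<eta>" and t: "t \<in> Y" "norm t \<le> 1" "g t \<ge> 1 - \<eta>"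
      and u: "0 \<le> u" "u \<le> 1" "norm (y k - (u *\<^sub>R s - (1 - u) *\<^sub>R t)) < \<eta>"
      using st[rule_format, of k] by blast
    \<comment> \<open>Total error, so that \<open>z - s = r - (1 - u)(s + t)\<close> and
      \<open>z + t = r + u (s + t)\<close>.\<close>
    define r where "r = (z - y k) + (y k - (u *\<^sub>R s - (1 - u) *\<^sub>R t))"
    have "norm (z - y k) < \<eta>" using b(3) k by (simp add: y_def)
    with u(3) have r: "norm r < 2 * \<eta>"
      unfolding r_def by (intro norm_triangle_lt) linarith
    have "infdist z (slice Y f \<epsilon>) \<le> dist z s"
      using slice s by (intro infdist_le) auto
    also have "dist z s = norm (r - (1 - u) *\<^sub>R (s + t))"
      by (simp add: dist_norm r_def algebra_simps)
    also have "\<dots> \<le> norm r + (1 - u) * (norm s + norm t)"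
      using norm_triangle_ineq4[of r "(1 - u) *\<^sub>R (s + t)"] u(1,2)
        mult_left_mono[OF norm_triangle_ineq[of s t], of "1 - u"] by simp
    also have "(1 - u) * (norm s + norm t) \<le> (1 - u) * 2"
      using u s t by (intro mult_left_mono) auto
    finally have 1: "infdist z (slice Y f \<epsilon>) \<le> norm r + (1 - u) * 2" by simp
    have "infdist z (uminus ` slice Y f \<epsilon>) \<le> dist z (- t)"
      using slice t by (intro infdist_le) auto
    also have "dist z (- t) = norm (r + u *\<^sub>R (s + t))"
      by (simp add: dist_norm r_def algebra_simps)
    also have "\<dots> \<le> norm r + u * (norm s + norm t)"
      using norm_triangle_ineq[of r "u *\<^sub>R (s + t)"] u(1,2)
        mult_left_mono[OF norm_triangle_ineq[of s t], of u] by simp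
    also have "u * (norm s + norm t) \<le> u * 2"
      using u s t by (intro mult_left_mono) auto
    finally have 2: "infdist z (uminus ` slice Y f \<epsilon>) \<le> norm r + u * 2" by simp
    show ?thesis using 1 2 r \<eta>(3) by argo
  qed
  moreover have "x \<in> slice Y f \<epsilon>" using slice x g(2) by simp
  ultimately show "\<exists>f \<in> dual_sphere Y. x \<in> slice Y f \<epsilon> \<and>
      (\<forall>y \<in> Y \<inter> sphere 0 1. infdist y (slice Y f \<epsilon>) + infdist y (uminus ` slice Y f \<epsilon>) < 2 + \<epsilon>)"
    using f(1) by blast
qed

theorem mainTheorem8:
  assumes "lush (UNIV :: 'a::banach set)"
  shows "local_GL_space (UNIV :: 'a set)"
  unfolding local_GL_space_def
proof (intro allI impI, elim conjE)
  fix X :: "'a set" assume "separable_space (top_of_set X)"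
  then obtain C where C: "countable C" "X \<subseteq> closure C"
    by (auto simp: separable_space_def closure_of_subtopology)
  obtain D where D: "countable D" "C \<subseteq> D" "subspace (closure D)" "has_lush_witnesses (closure D)"
    by (rule separable_lush_subspace[OF C(1) lush_imp_has_lush_witnesses[OF assms]])
  have "X \<subseteq> closure D" using C(2) closure_mono[OF D(2)] by blast
  moreover have "GL_space (closure D)" using D by (intro separable_lush_imp_GL_space)
  ultimately show "\<exists>Y. subspace Y \<and> closed Y \<and> X \<subseteq> Y \<and> Y \<subseteq> UNIV \<and> GL_space Y"
    using D(3) by (intro exI[of _ "closure D"]) simp
qed

end
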